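(* Let $y\in\operatorname{supp}\mu$ with $\mu(\{y\})=0$. Then $$\liminf_{r\to0}\frac{\log\tau_{B(y,r)}(x)}{-\log\mu(B(y,r))}\ge1\qquad\text{for } \mu\text{-a.e. } x\in X.$$
   Context: Standing assumptions: $(X,d)$ is a metric space, $\mu$ is a Borel probability measure on $X$, and $T:X\to X$ is measurable and preserves $\mu$, i.e. $\mu(T^{-1}A)=\mu(A)$ for all Borel $A$. $\mathbb{N}=\{1,2,\dots\}$. $B(y,r)=\{x\in X: d(x,y)\le r\}$ is the closed ball of center $y$ and radius $r>0$. The support $\operatorname{supp}\mu$ is the set of $y$ with $\mu(B(y,r))>0$ for all $r>0$. For measurable $A\subset X$, the waiting time is $\tau_A(x)=\min\{n\in\mathbb{N}:T^nx\in A\}\in\mathbb{N}\cup\{\infty\}$ (with $\log\infty=\infty$). The limit is over the continuous parameter $r\downarrow0$. *)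

theory Defs
  imports "HOL-Probability.Probability"
begin

definition measure_support :: "'a::metric_space measure \<Rightarrow> 'a set"
  where "measure_support \<mu> = {y. \<forall>r>0. measure \<mu> (cball y r) > 0}"

text \<open>The infimum of the empty set in \<^typ>\<open>enat\<close> is \<open>\<infinity>\<close>, so the waiting time is infinite
  when the orbit never enters \<open>A\<close> at a positive time.\<close>

definition waiting_time :: "('a \<Rightarrow> 'a) \<Rightarrow> 'a set \<Rightarrow> 'a \<Rightarrow> enat"
  where "waiting_time T A x = (INF n\<in>{n::nat. n \<ge> 1 \<and> (T ^^ n) x \<in> A}. enat n)"

text \<open>Natural logarithm with \<open>log \<infinity> = \<infinity>\<close>. Waiting times are at least \<open>1\<close>,
  so the value at \<open>0\<close> plays no role.\<close>

definition ln_enat :: "enat \<Rightarrow> ereal"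
  where "ln_enat n = (case n of enat k \<Rightarrow> ereal (ln (real k)) | \<infinity> \<Rightarrow> \<infinity>)"

end

theory Submission
  imports Defs "HOL-Real_Asymp.Real_Asymp"
begin

text \<open>
  By invariance and a union bound, a set of measure at most \<open>u\<close> is reached within time \<open>c\<close> with
  probability at most \<open>c u\<close>. The points \<open>x\<close> for which the closed ball around \<open>y\<close> through \<open>x\<close> has
  measure at most \<open>exp (- k)\<close> form a set \<open>A k\<close> of measure at most \<open>exp (- k)\<close>, even if the measure
  of balls jumps as a function of the radius. Since \<open>1 / k\<^sup>2\<close> is summable, Borel--Cantelli shows that
  almost every orbit eventually avoids \<open>A k\<close> up to time \<open>exp k / k\<^sup>2\<close>. A ball of measure
  \<open>exp (- L)\<close> lies in \<open>A k\<close> for \<open>k = \<lfloor>L\<rfloor>\<close>, so its waiting time has logarithm at least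
  \<open>L - 1 - 2 ln L\<close>.
\<close>

lemma ln_enat_waiting_time_ge:
  assumes "0 < c" and "\<And>n. 1 \<le> n \<Longrightarrow> real n \<le> c \<Longrightarrow> (T ^^ n) x \<notin> A"
  shows "ereal (ln c) \<le> ln_enat (waiting_time T A x)"
proof (cases "waiting_time T A x")
  case (enat k)
  let ?N = "{n::nat. n \<ge> 1 \<and> (T ^^ n) x \<in> A}"
  have "?N \<noteq> {}"
  proof
    assume "?N = {}"
    then have "waiting_time T A x = \<infinity>"
      unfolding waiting_time_def by (simp only: image_empty Inf_empty top_enat_def)
    with enat show False by simp
  qed
  then obtain n where "enat n \<in> enat ` ?N"
    by blast
  \<comment> \<open>By well-ordering of \<open>enat\<close> the infimum is attained, so a finite
    waiting time \<open>k\<close> is itself an entry time and must exceed \<open>c\<close>.\<close>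
  from wellorder_InfI[OF this] have "waiting_time T A x \<in> enat ` ?N"
    unfolding waiting_time_def .
  then have "k \<in> ?N"
    using enat by auto
  then have "c < real k"
    using assms(2)[of k] by fastforce
  then show ?thesis
    using enat \<open>0 < c\<close> by (simp add: ln_enat_def)
qed (simp add: ln_enat_def)

text \<open>Continuity from above applies along the radii \<open>1 / (n + 1)\<close>, whose balls
  shrink to \<open>{y}\<close>; monotonicity in the radius carries the limit over to continuous
  \<open>r\<close>.\<close>

lemma tendsto_measure_cball:
  fixes \<mu> :: "'a::metric_space measure"
  assumes "finite_measure \<mu>" and sets_eq: "sets \<mu> = sets borel"
  shows "((\<lambda>r. measure \<mu> (cball y r)) \<longlongrightarrow> measure \<mu> {y}) (at_right 0)"
proof -
  interpret finite_measure \<mu> by fact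
  let ?B = "\<lambda>n. cball y (inverse (real (Suc n)))"
  have "(\<Inter>n. ?B n) = {y}"
  proof safe
    fix x assume "x \<in> (\<Inter>n. ?B n)"
    then have "\<And>n. dist y x \<le> inverse (real (Suc n))" by auto
    then show "x = y"
      by (metis dist_commute not_less reals_Archimedean zero_less_dist_iff)
  qed auto
  moreover have "decseq ?B"
    by (intro decseq_SucI subset_cball) (simp add: field_simps)
  ultimately have lim: "(\<lambda>n. measure \<mu> (?B n)) \<longlonglongrightarrow> measure \<mu> {y}"
    using finite_Lim_measure_decseq[of ?B] by (simp add: sets_eq image_subset_iff)
  have mono: "measure \<mu> S \<le> measure \<mu> (cball y r)" if "S \<subseteq> cball y r" for S r
    using that by (intro finite_measure_mono) (auto simp: sets_eq)
  show ?thesis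
  proof (rule order_tendstoI)
    fix a assume "a < measure \<mu> {y}"
    then have "a < measure \<mu> (cball y r)" if "0 < r" for r
      using that mono[of "{y}" r] by simp
    then show "\<forall>\<^sub>F r in at_right 0. a < measure \<mu> (cball y r)"
      by (intro eventually_at_rightI[of 0 1]) auto
  next
    fix a assume "measure \<mu> {y} < a"
    then obtain n where n: "measure \<mu> (?B n) < a"
      using order_tendstoD(2)[OF lim] by (auto simp: eventually_sequentially)
    have "measure \<mu> (cball y r) < a" if "r < inverse (real (Suc n))" for r
      using that n mono[OF subset_cball, of r "inverse (real (Suc n))"] by simp
    then show "\<forall>\<^sub>F r in at_right 0. measure \<mu> (cball y r) < a"
      by (intro eventually_at_rightI[of 0 "inverse (real (Suc n))"]) auto
  qed
qed

text \<open>Membership in \<open>A\<close> depends only on \<open>dist y x\<close>, and the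
  admissible radii form a down-set of reals. Hence \<open>A\<close> is the whole space, a closed
  ball or an open ball about \<open>y\<close>: either a ball of measure at most \<open>u\<close> or
  an increasing union of such balls.\<close>

lemma measure_cball_sublevel_le:
  fixes \<mu> :: "'a::metric_space measure" and y :: 'a
  assumes "finite_measure \<mu>" and sets_eq: "sets \<mu> = sets borel" and "0 \<le> u"
  defines "A \<equiv> {x. measure \<mu> (cball y (dist y x)) \<le> u}"
  shows "A \<in> sets \<mu>" and "measure \<mu> A \<le> u"
proof -
  interpret finite_measure \<mu> by fact
  have [simp]: "cball y r \<in> sets \<mu>" for r
    by (auto simp: sets_eq)
  have mono: "measure \<mu> (cball y r) \<le> measure \<mu> (cball y s)" if "r \<le> s" for r s
    using that by (intro finite_measure_mono subset_cball) auto
  have lim_le: "measure \<mu> (\<Union>n. cball y (f n)) \<le> u"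
    if "incseq f" "\<And>n::nat. measure \<mu> (cball y (f n)) \<le> u" for f
  proof (rule LIMSEQ_le_const2)
    show "(\<lambda>n. measure \<mu> (cball y (f n))) \<longlonglongrightarrow> measure \<mu> (\<Union>n. cball y (f n))"
      using that(1) by (intro finite_Lim_measure_incseq)
        (simp_all add: incseq_def subset_cball image_subset_iff)
  qed (use that in auto)
  define D where "D = {r. measure \<mu> (cball y r) \<le> u}"
  have A: "A = {x. dist y x \<in> D}"
    by (simp add: A_def D_def)
  have down: "r \<in> D" if "s \<in> D" "r \<le> s" for r s
    using that mono[of r s] by (auto simp: D_def)
  \<comment> \<open>A ball of negative radius is empty, so \<open>D\<close> is nonempty and
    \<open>Sup D\<close> is meaningful once \<open>D\<close> is bounded above.\<close>
  have ne: "-1 \<in> D"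
    using \<open>0 \<le> u\<close> by (simp add: D_def)
  consider "\<not> bdd_above D" | "bdd_above D" "Sup D \<in> D" | "bdd_above D" "Sup D \<notin> D"
    by blast
  then have "A \<in> sets \<mu> \<and> measure \<mu> A \<le> u"
  proof cases
    case 1
    then have all: "r \<in> D" for r
      using down by (metis bdd_above.I linear)
    have "A = (\<Union>n. cball y (real n))"
      using all real_arch_simple by (auto simp: A)
    then show ?thesis
      using lim_le[of real] all by (auto simp: D_def incseq_def)
  next
    case 2
    then have "A = cball y (Sup D)"
      using down cSup_upper by (auto simp: A)
    then show ?thesis
      using 2 by (simp add: D_def)
  next
    case 3
    \<comment> \<open>Here \<open>A\<close> is the open ball of radius \<open>Sup D\<close>,
      exhausted from inside by closed balls whose radii \<open>?f n\<close> lie in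
      \<open>D\<close>.\<close>
    let ?f = "\<lambda>n. Sup D - inverse (real (Suc n))"
    have lt: "r \<in> D \<longleftrightarrow> r < Sup D" for r
      using 3 down ne by (metis cSup_upper empty_iff less_cSupD less_le)
    have "r < Sup D \<longleftrightarrow> (\<exists>n. r \<le> ?f n)" for r
    proof
      assume "r < Sup D"
      then show "\<exists>n. r \<le> ?f n"
        using reals_Archimedean[of "Sup D - r"] by (auto simp: algebra_simps intro: less_imp_le)
    next
      assume "\<exists>n. r \<le> ?f n"
      then obtain n where "r \<le> ?f n" ..
      also have "?f n < Sup D" by simp
      finally show "r < Sup D" .
    qed
    then have "A = (\<Union>n. cball y (?f n))"
      by (auto simp: A lt)
    moreover have "incseq ?f"
      by (rule incseq_SucI) (simp add: field_simps)
    moreover have "measure \<mu> (cball y (?f n)) \<le> u" for n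
      using lt[of "?f n"] by (simp add: D_def)
    ultimately show ?thesis
      using lim_le[of ?f] by auto
  qed
  then show "A \<in> sets \<mu>" "measure \<mu> A \<le> u" by auto
qed

lemma measure_funpow_vimage:
  assumes T: "T \<in> measurable \<mu> \<mu>" and sp: "space \<mu> = UNIV"
    and inv: "\<And>A. A \<in> sets \<mu> \<Longrightarrow> measure \<mu> (T -` A) = measure \<mu> A"
    and A: "A \<in> sets \<mu>"
  shows "(T ^^ n) -` A \<in> sets \<mu>" and "measure \<mu> ((T ^^ n) -` A) = measure \<mu> A"
proof -
  have "(T ^^ n) -` A \<in> sets \<mu> \<and> measure \<mu> ((T ^^ n) -` A) = measure \<mu> A"
  proof (induction n)
    case (Suc n)
    \<comment> \<open>Peeling off the innermost \<open>T\<close> gives a \<open>T\<close>-preimage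
      of the set in the induction hypothesis, to which invariance applies.\<close>
    have "(T ^^ Suc n) -` A = T -` ((T ^^ n) -` A)"
      by (auto simp: funpow_swap1)
    then show ?case
      using Suc inv measurable_sets[OF T, of "(T ^^ n) -` A"] sp
      by (simp del: funpow.simps)
  qed (simp add: A)
  then show "(T ^^ n) -` A \<in> sets \<mu>" "measure \<mu> ((T ^^ n) -` A) = measure \<mu> A" by auto
qed

lemma measure_early_entry_le:
  fixes T :: "'a \<Rightarrow> 'a" and c :: real
  assumes "finite_measure \<mu>" and "T \<in> measurable \<mu> \<mu>" and "space \<mu> = UNIV"
    and "\<And>A. A \<in> sets \<mu> \<Longrightarrow> measure \<mu> (T -` A) = measure \<mu> A"
    and "A \<in> sets \<mu>" and "0 \<le> c"
  defines "E \<equiv> {x. \<exists>n\<ge>1. real n \<le> c \<and> (T ^^ n) x \<in> A}"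
  shows "E \<in> sets \<mu>" and "measure \<mu> E \<le> c * measure \<mu> A"
proof -
  interpret finite_measure \<mu> by fact
  note T = measure_funpow_vimage[OF assms(2-5)]
  \<comment> \<open>At most \<open>c\<close> positive integers are bounded by \<open>c\<close>, so
    the real time bound becomes a finite index set for the union bound.\<close>
  define I where "I = {1..nat \<lfloor>c\<rfloor>}"
  have "n \<in> I \<longleftrightarrow> 1 \<le> n \<and> real n \<le> c" for n
    using \<open>0 \<le> c\<close> by (auto simp: I_def le_nat_iff le_floor_iff)
  then have E: "E = (\<Union>n\<in>I. (T ^^ n) -` A)"
    by (auto simp: E_def)
  show "E \<in> sets \<mu>"
    unfolding E using T(1) by (auto simp: I_def)
  have "measure \<mu> E \<le> (\<Sum>n\<in>I. measure \<mu> ((T ^^ n) -` A))"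
    unfolding E using T(1) by (intro finite_measure_subadditive_finite) (auto simp: I_def)
  also have "\<dots> = real (nat \<lfloor>c\<rfloor>) * measure \<mu> A"
    by (simp add: T(2) I_def)
  also have "\<dots> \<le> c * measure \<mu> A"
    using \<open>0 \<le> c\<close> by (intro mult_right_mono) auto
  finally show "measure \<mu> E \<le> c * measure \<mu> A" .
qed

theorem corollary3p4:
  fixes \<mu> :: "'a::metric_space measure" and T :: "'a \<Rightarrow> 'a" and y :: 'a
  assumes "prob_space \<mu>"
    and "sets \<mu> = sets borel"
    and "T \<in> measurable \<mu> \<mu>"
    and "\<And>A. A \<in> sets borel \<Longrightarrow> measure \<mu> (T -` A) = measure \<mu> A"
    and "y \<in> measure_support \<mu>"
    and "measure \<mu> {y} = 0"
  shows "AE x in \<mu>. Liminf (at_right 0)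
           (\<lambda>r::real. ln_enat (waiting_time T (cball y r) x) /
                      ereal (- ln (measure \<mu> (cball y r)))) \<ge> 1"
proof -
  interpret prob_space \<mu> by fact
  have space: "space \<mu> = UNIV"
    using sets_eq_imp_space_eq[OF assms(2)] by simp
  define m where "m r = measure \<mu> (cball y r)" for r
  define L where "L r = - ln (m r)" for r
  have m_pos: "0 < m r" if "0 < r" for r
    using assms(5) that by (auto simp: measure_support_def m_def)
  \<comment> \<open>Since \<open>{y}\<close> is null, \<open>m\<close> tends to 0; since
    \<open>y\<close> is in the support, it does so through positive values, where \<open>ln\<close>
    tends to minus infinity.\<close>
  have "(m \<longlongrightarrow> 0) (at_right 0)"
    using tendsto_measure_cball[OF finite_measure_axioms assms(2), of y] assms(6)
    by (simp add: m_def[abs_def])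
  then have "filterlim m (at_right 0) (at_right 0)"
    using m_pos by (intro tendsto_imp_filterlim_at_right eventually_at_rightI[of 0 1]) auto
  then have L_lim: "filterlim L at_top (at_right 0)"
    unfolding L_def
    by (intro filterlim_compose[OF filterlim_uminus_at_top_at_bot] filterlim_compose[OF ln_at_0])

  \<comment> \<open>Indexing by integers instead of radii leaves countably many events, hence a
    single null set for all \<open>r\<close>.\<close>
  define A where "A k = {x. measure \<mu> (cball y (dist y x)) \<le> exp (- real k)}" for k
  \<comment> \<open>The factor \<open>1 / k^2\<close> makes \<open>c k * exp (- k)\<close> summable
    and costs only \<open>2 * ln k\<close> in \<open>ln (c k)\<close>. For \<open>k = 0\<close>,
    division by zero gives \<open>c 0 = 0\<close>, so \<open>E 0\<close> is empty.\<close>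
  define c where "c k = exp (real k) / real k ^ 2" for k
  define E where "E k = {x. \<exists>n\<ge>1. real n \<le> c k \<and> (T ^^ n) x \<in> A k}" for k
  have A: "A k \<in> sets \<mu>" "measure \<mu> (A k) \<le> exp (- real k)" for k
    using measure_cball_sublevel_le[OF finite_measure_axioms assms(2), of "exp (- real k)" y]
    by (auto simp: A_def)
  have c_nonneg: "0 \<le> c k" for k
    by (simp add: c_def)
  have inv: "measure \<mu> (T -` B) = measure \<mu> B" if "B \<in> sets \<mu>" for B
    using that assms(2,4) by simp
  have E: "E k \<in> sets \<mu>" "measure \<mu> (E k) \<le> c k * measure \<mu> (A k)" for k
    using measure_early_entry_le[OF finite_measure_axioms assms(3) space _ A(1) c_nonneg, of k k]
      inv by (simp_all add: E_def)
  have "measure \<mu> (E k) \<le> inverse (real k ^ 2)" for k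
  proof -
    have "measure \<mu> (E k) \<le> c k * exp (- real k)"
      using E(2)[of k] mult_left_mono[OF A(2) c_nonneg, of k] by (rule order_trans)
    also have "\<dots> = inverse (real k ^ 2)"
      by (simp add: c_def exp_minus field_simps)
    finally show ?thesis .
  qed
  then have "summable (\<lambda>k. measure \<mu> (E k))"
    by (intro summable_comparison_test'[OF inverse_power_summable[of 2]]) auto
  then have "AE x in \<mu>. \<forall>\<^sub>F k in sequentially. x \<in> space \<mu> - E k"
    using E(1) by (intro borel_cantelli_AE1) (auto simp: emeasure_eq_measure)
  then show ?thesis
  proof eventually_elim
    case (elim x)
    \<comment> \<open>The statement for almost all integers \<open>k\<close> is pulled back to all
      small real \<open>r\<close> along \<open>k = \<lfloor>L r\<rfloor>\<close>.\<close>
    have floor_lim: "filterlim (\<lambda>r. nat \<lfloor>L r\<rfloor>) sequentially (at_right 0)"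
      by (intro filterlim_compose[OF filterlim_nat_sequentially]
          filterlim_compose[OF filterlim_floor_sequentially] L_lim)
    have "\<forall>\<^sub>F r in at_right 0. x \<notin> E (nat \<lfloor>L r\<rfloor>)"
      using eventually_compose_filterlim[OF elim floor_lim] by (simp add: space)
    moreover have "\<forall>\<^sub>F r in at_right 0. 1 \<le> L r"
      using L_lim by (simp add: filterlim_at_top)
    moreover have "\<forall>\<^sub>F r in at_right (0::real). 0 < r"
      by (rule eventually_at_right_less)
    ultimately have le: "\<forall>\<^sub>F r in at_right 0. ereal ((L r - 1 - 2 * ln (L r)) / L r)
        \<le> ln_enat (waiting_time T (cball y r) x) / ereal (L r)"
    proof eventually_elim
      case (elim r)
      define k where "k = nat \<lfloor>L r\<rfloor>"
      have k: "1 \<le> k" "real k \<le> L r" "L r - 1 \<le> real k"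
        using elim(2) unfolding k_def by linarith+
      have "m r = exp (- L r)"
        using m_pos[OF elim(3)] by (simp add: L_def)
      then have "m r \<le> exp (- real k)"
        using k by simp
      moreover have "m s \<le> m r" if "s \<le> r" for s
        unfolding m_def using that
        by (intro finite_measure_mono subset_cball) (auto simp: assms(2))
      \<comment> \<open>A point of \<open>cball y r\<close> has distance \<open>s \<le> r\<close>
        from \<open>y\<close>, so \<open>m s \<le> m r \<le> exp (- k)\<close>.\<close>
      ultimately have sub: "cball y r \<subseteq> A k"
        by (fastforce simp: A_def m_def)
      have "ln (c k) = real k - 2 * ln (real k)"
        using k by (simp add: c_def ln_div ln_realpow)
      moreover have "ln (real k) \<le> ln (L r)"
        using k by simp
      \<comment> \<open>The floor is bounded below by \<open>L r - 1\<close> in the linear term and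
        above by \<open>L r\<close> inside the logarithm.\<close>
      ultimately have "L r - 1 - 2 * ln (L r) \<le> ln (c k)"
        using k by linarith
      also have "ereal (ln (c k)) \<le> ln_enat (waiting_time T (cball y r) x)"
        using elim(1) sub k by (intro ln_enat_waiting_time_ge) (auto simp: c_def E_def k_def)
      finally have "ereal (L r - 1 - 2 * ln (L r)) \<le> ln_enat (waiting_time T (cball y r) x)"
        by simp
      then have "ereal (L r - 1 - 2 * ln (L r)) / ereal (L r)
          \<le> ln_enat (waiting_time T (cball y r) x) / ereal (L r)"
        using elim(2) by (intro ereal_divide_right_mono) auto
      then show ?case
        using elim(2) by simp
    qed
    have "((\<lambda>t::real. (t - 1 - 2 * ln t) / t) \<longlongrightarrow> 1) at_top"
      by real_asymp
    from filterlim_compose[OF this L_lim]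
    have "((\<lambda>r. ereal ((L r - 1 - 2 * ln (L r)) / L r)) \<longlongrightarrow> 1) (at_right 0)"
      by (simp add: one_ereal_def)
    then have "Liminf (at_right 0) (\<lambda>r. ereal ((L r - 1 - 2 * ln (L r)) / L r)) = 1"
      by (intro lim_imp_Liminf) auto
    then show ?case
      using Liminf_mono[OF le] by (simp add: L_def m_def)
  qed
qed

end
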